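(* Let $D\subseteq\mathbb{C}^{n\times m}$, let $F:D\times D\to D$ be a binary operator satisfying $F(F(X,Y),Z)=F(X,F(Y,Z))$ for all $X,Y,Z\in D$, let $X_1\in D$, and let the sequence $\{X_k\}_{k\ge 1}$ be defined by $X_{k+1}=F(X_k,X_1)$ for $k\ge 1$. Then $$X_{i+j}=F(X_i,X_j)\qquad\text{for all integers } i,j\ge 1.$$
   Context: An iteration $X_{k+1}=F(X_k,X_1)$, $k\ge1$, with $F:D\times D\to D$ and $D\subseteq\mathbb{C}^{n\times m}$, is said to have the semigroup property if $F(F(X,Y),Z)=F(X,F(Y,Z))$ for all $X,Y,Z\in D$. The conclusion is called the "discrete flow property". *)

theory Defs
  imports "HOL-Analysis.Analysis"
begin

end

theory Submission
  imports Defs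
begin

text \<open>
  The iterate \<open>X k\<close> is the \<open>k\<close>-th power of \<open>X 1\<close> in the semigroup \<open>(D, F)\<close>, so the claim is
  the law of exponents. Induction on \<open>j\<close> proves it: the recursion splits off one factor \<open>X 1\<close>
  on the right, and associativity moves that factor into the second argument. As associativity
  is known only on \<open>D\<close>, this rests on the closure of \<open>D\<close> under \<open>F\<close>, which keeps all
  iterates in \<open>D\<close>.
\<close>

theorem theorem3p2:
  fixes D :: "(complex ^ 'm ^ 'n) set"
    and F :: "(complex ^ 'm ^ 'n) \<times> (complex ^ 'm ^ 'n) \<Rightarrow> complex ^ 'm ^ 'n"
    and X :: "nat \<Rightarrow> complex ^ 'm ^ 'n"
  assumes F_closed: "F \<in> D \<times> D \<rightarrow> D"
    and semigroup_property:
      "\<forall>A\<in>D. \<forall>B\<in>D. \<forall>C\<in>D. F (F (A, B), C) = F (A, F (B, C))"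
    and X1: "X 1 \<in> D"
    and iteration: "\<forall>k\<ge>1. X (k + 1) = F (X k, X 1)"
  shows "\<forall>i\<ge>1. \<forall>j\<ge>1. X (i + j) = F (X i, X j)"
proof (intro allI impI)
  have in_D: "X k \<in> D" if "k \<ge> 1" for k
    using that
  proof (induction k rule: dec_induct)
    case base
    show ?case by (rule X1)
  next
    case (step k)
    have "F (X k, X 1) \<in> D"
      using F_closed step.IH X1 by blast
    then show ?case
      using iteration step.hyps by simp
  qed
  fix i j :: nat
  assume i: "i \<ge> 1" and j: "j \<ge> 1"
  from j show "X (i + j) = F (X i, X j)"
  proof (induction j rule: dec_induct)
    case base
    show ?case using iteration i by simp
  next
    case (step j)
    have "X (i + Suc j) = F (X (i + j), X 1)"
      using iteration i by simp
    also have "\<dots> = F (F (X i, X j), X 1)"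
      by (simp only: step.IH)
    also have "\<dots> = F (X i, F (X j, X 1))"
      using semigroup_property in_D[OF i] in_D[OF step.hyps(1)] X1 by blast
    also have "\<dots> = F (X i, X (Suc j))"
      using iteration step.hyps(1) by simp
    finally show ?case .
  qed
qed

end
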